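(* Let $M$ and $N$ be nonempty bounded closed convex subsets of a Hilbert space $X$, and suppose $F: M\cup N\to M\cup N$ satisfies (1) $F(M)\subseteq M$ and $F(N)\subseteq N$; and (2) $\|Fw-Fz\|\le\|w-z\|$ for all $w\in M$, $z\in N$. Let $\epsilon\in(0,1/2)$, let $\eta_n,\delta_n\in(\epsilon,1-\epsilon)$ for $n=0,1,2,\dots$, let $w_0\in M$, and define $$z_n=(1-\delta_n)w_n+\delta_nFw_n,\qquad w_{n+1}=P^n\big((1-\eta_n)w_n+\eta_nFz_n\big),\qquad n=0,1,2,\dots.$$ Then $\lim_{n\to\infty}\|w_n-Fw_n\|=0$. Moreover, if $F(M)$ lies in a compact set and $\|w_n-Fz_n\|\to0$, then $\{w_n\}$ converges (in norm) to a fixed point of $F$.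
   Context: For a nonempty closed convex subset $A$ of a Hilbert space $X$, $P_A:X\to A$ denotes the metric (nearest point) projection. $P:X\to M$ is defined by $P(w)=P_M(P_N(w))$, and $P^n$ is its $n$-fold iterate ($P^0$ is the identity). The map $F$ is not assumed to be continuous. *)

theory Defs
  imports "HOL-Analysis.Analysis"
begin

text \<open>
  The library's \<open>closest_point\<close> requires the class \<open>heine_borel\<close>, hence is confined to
  finite dimension.  The description below is well defined (existence and uniqueness of the
  nearest point) whenever \<open>A\<close> is a nonempty closed convex subset of a Hilbert space.
\<close>

definition metric_projection :: "'a::metric_space set \<Rightarrow> 'a \<Rightarrow> 'a"
  where "metric_projection A x = (THE p. p \<in> A \<and> (\<forall>q\<in>A. dist x p \<le> dist x q))"

definition projection_comp :: "'a::metric_space set \<Rightarrow> 'a set \<Rightarrow> 'a \<Rightarrow> 'a"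
  where "projection_comp M N w = metric_projection M (metric_projection N w)"

end

theory Submission
  imports Defs
begin

text \<open>
  The proof rests on two observations about the pair \<open>(M, N)\<close>.

  \<^item> \<open>N - M\<close> contains a vector \<open>h\<close> of least norm, and the identity
    \<open>\<parallel>v - u\<parallel>\<^sup>2 \<ge> \<parallel>h\<parallel>\<^sup>2 + \<parallel>v - u - h\<parallel>\<^sup>2\<close> for \<open>u \<in> M\<close>, \<open>v \<in> N\<close> controls how far a nearly optimal
    pair is from being a translate by \<open>h\<close> (lemma \<open>gap_vector_defect\<close>).  The vector \<open>h\<close> comes from a fixed
    point of the nonexpansive map \<open>P = P\<^sub>M \<circ> P\<^sub>N\<close> on \<open>M\<close>.

  \<^item> On \<open>M\<^sub>0 = {x \<in> M. x + h \<in> N}\<close> the map \<open>F\<close> commutes with the translation by \<open>h\<close>, and the parallelogram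
    law turns the relative condition on \<open>F\<close> into ordinary nonexpansiveness.  Hence \<open>F\<close> has a fixed point
    \<open>x \<in> M\<^sub>0\<close>, and \<open>y = x + h \<in> N\<close> is fixed as well (lemma \<open>fixed_point_in_proximal_set\<close>).

  Both fixed points come from Browder's theorem in Hilbert space (lemma \<open>nonexpansive_fixed_point\<close>), which is
  proved here without weak topologies: the fixed points of the contractions that pull towards a base point
  have increasing norms and are Cauchy.

  Convergence of \<open>\<parallel>w\<^sub>n - F w\<^sub>n\<parallel>\<close> is then a Fejer argument, but relative to the point \<open>y\<close> of the \<^emph>\<open>other\<close>
  set: the hypothesis on \<open>F\<close> bounds \<open>\<parallel>F w - y\<parallel>\<close> for \<open>w \<in> M\<close>, and although \<open>y\<close> need not be fixed by \<open>P\<close>,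
  still \<open>\<parallel>P u - y\<parallel> \<le> \<parallel>u - y\<parallel>\<close> on \<open>M\<close>, because exchanging two points of \<open>M\<close> and \<open>N\<close> by projections does not
  increase their distance (lemma \<open>crossed_projections_nonexpansive\<close>).  Strict convexity of the squared norm
  makes \<open>\<parallel>w\<^sub>n - y\<parallel>\<^sup>2\<close> drop in each step by at least \<open>\<epsilon>\<^sup>3 \<parallel>w\<^sub>n - F w\<^sub>n\<parallel>\<^sup>2\<close>.

  For the second part, \<open>n\<close> applications of \<open>P\<close> bring a point of \<open>M\<close> within \<open>\<parallel>h\<parallel> + O(1/\<surd>n)\<close> of \<open>N\<close>, uniformly
  on \<open>M\<close> (lemma \<open>iterates_approach_gap\<close>).  Since \<open>w\<^sub>n\<close> is close to \<open>F w\<^sub>n\<close>, compactness gives a cluster point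
  \<open>q\<close> of \<open>w\<close>, and the uniform rate puts \<open>q\<close> in \<open>M\<^sub>0\<close>.  As \<open>F\<close> need not be continuous at \<open>q\<close>, the fixed-point
  equation is first obtained for \<open>q + h \<in> N\<close>, where the relative condition compares it with \<open>w\<^sub>n\<close>, and then
  carried over to \<open>q\<close>.  Now \<open>\<parallel>w\<^sub>n - (q + h)\<parallel>\<close> is decreasing and tends to \<open>\<parallel>h\<parallel>\<close> along a subsequence, hence
  everywhere, and this forces \<open>w\<^sub>n \<rightarrow> q\<close>.
\<close>

section \<open>Nearest points in Hilbert space\<close>

lemma Cauchy_if_sq_dist_le:
  fixes x :: "nat \<Rightarrow> 'a::real_normed_vector"
  assumes le: "\<And>m n. m \<le> n \<Longrightarrow> (norm (x m - x n))\<^sup>2 \<le> r m" and r: "r \<longlonglongrightarrow> 0"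
  shows "Cauchy x"
proof (rule CauchyI')
  fix e :: real assume e: "0 < e"
  have "eventually (\<lambda>m. r m < e\<^sup>2) sequentially"
    using order_tendstoD(2)[OF r, of "e\<^sup>2"] e by simp
  then obtain K where K: "\<And>m. m \<ge> K \<Longrightarrow> r m < e\<^sup>2"
    by (auto simp: eventually_sequentially)
  have "dist (x m) (x n) < e" if "m \<ge> K" "n > m" for m n
  proof -
    have "(norm (x m - x n))\<^sup>2 < e\<^sup>2" using le[of m n] K[of m] that by simp
    then show ?thesis using e by (simp add: dist_norm power2_less_imp_less)
  qed
  then show "\<exists>K. \<forall>m\<ge>K. \<forall>n>m. dist (x m) (x n) < e" by blast
qed

text \<open>A minimizing sequence for the squared distance is Cauchy by the parallelogram law, since midpoints stay
  in the convex set.\<close>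

lemma nearest_point_exists:
  fixes S :: "'a::{real_inner,complete_space} set"
  assumes "S \<noteq> {}" "closed S" "convex S"
  shows "\<exists>p\<in>S. \<forall>q\<in>S. dist x p \<le> dist x q"
proof -
  define f where "f q = (norm (x - q))\<^sup>2" for q
  define D where "D = (INF q\<in>S. f q)"
  have bdd: "bdd_below (f ` S)" by (auto simp: f_def intro!: bdd_belowI[of _ 0])
  have D: "D \<le> f q" if "q \<in> S" for q
    unfolding D_def using bdd that by (rule cINF_lower)
  have "\<exists>q\<in>S. f q < D + 1 / real (Suc n)" for n
    using cINF_less_iff[OF assms(1) bdd, of "D + 1 / real (Suc n)"] by (simp add: D_def)
  then obtain a where aS: "\<And>n. a n \<in> S" and a: "\<And>n. f (a n) < D + 1 / real (Suc n)"
    by metis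
  have "Cauchy a"
  proof (rule Cauchy_if_sq_dist_le)
    fix m n :: nat assume mn: "m \<le> n"
    have "(1/2) *\<^sub>R a m + (1/2) *\<^sub>R a n \<in> S"
      using convexD[OF assms(3) aS aS, of "1/2" "1/2"] by simp
    then have "D \<le> f ((1/2) *\<^sub>R a m + (1/2) *\<^sub>R a n)" by (rule D)
    moreover have "(norm (a m - a n))\<^sup>2 =
        2 * f (a m) + 2 * f (a n) - 4 * f ((1/2) *\<^sub>R a m + (1/2) *\<^sub>R a n)"
      unfolding f_def power2_norm_eq_inner by (simp add: inner_simps inner_commute field_simps)
    moreover have "1 / real (Suc n) \<le> 1 / real (Suc m)" using mn by (simp add: field_simps)
    ultimately show "(norm (a m - a n))\<^sup>2 \<le> 4 * (1 / real (Suc m))"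
      using a[of m] a[of n] by linarith
  next
    show "(\<lambda>m. 4 * (1 / real (Suc m))) \<longlonglongrightarrow> 0"
      using tendsto_mult_right_zero[OF LIMSEQ_Suc[OF lim_1_over_n]] by simp
  qed
  then obtain p where p: "a \<longlonglongrightarrow> p" using Cauchy_convergent convergent_def by blast
  have pS: "p \<in> S" using closed_sequentially[OF assms(2) _ p] aS by blast
  have "f p \<le> D"
  proof (rule LIMSEQ_le)
    show "(\<lambda>n. f (a n)) \<longlonglongrightarrow> f p" unfolding f_def by (intro tendsto_intros p)
    show "(\<lambda>n. D + 1 / real (Suc n)) \<longlonglongrightarrow> D"
      using tendsto_add[OF tendsto_const LIMSEQ_Suc[OF lim_1_over_n], of D] by simp
    show "\<exists>N. \<forall>n\<ge>N. f (a n) \<le> D + 1 / real (Suc n)" using a less_imp_le by blast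
  qed
  then have "dist x p \<le> dist x q" if "q \<in> S" for q
    using D[OF that] by (simp add: f_def dist_norm power2_le_imp_le)
  with pS show ?thesis by blast
qed

lemma metric_projection_nearest:
  fixes S :: "'a::{real_inner,complete_space} set"
  assumes "S \<noteq> {}" "closed S" "convex S"
  shows "metric_projection S x \<in> S \<and> (\<forall>q\<in>S. dist x (metric_projection S x) \<le> dist x q)"
  unfolding metric_projection_def
proof (rule theI')
  show "\<exists>!p. p \<in> S \<and> (\<forall>q\<in>S. dist x p \<le> dist x q)"
    using nearest_point_exists[OF assms, of x] any_closest_point_unique[OF assms(3,2)] by blast
qed

lemma metric_projection_obtuse:
  fixes S :: "'a::{real_inner,complete_space} set"
  assumes "S \<noteq> {}" "closed S" "convex S" "q \<in> S"
  shows "(x - metric_projection S x) \<bullet> (q - metric_projection S x) \<le> 0"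
  using metric_projection_nearest[OF assms(1-3), of x] any_closest_point_dot[OF assms(3,2) _ assms(4)]
  by blast

lemma metric_projection_eqI:
  fixes S :: "'a::{real_inner,complete_space} set"
  assumes "S \<noteq> {}" "closed S" "convex S" "p \<in> S" "\<And>q. q \<in> S \<Longrightarrow> dist x p \<le> dist x q"
  shows "metric_projection S x = p"
  using metric_projection_nearest[OF assms(1-3), of x] any_closest_point_unique[OF assms(3,2)] assms(4,5)
  by blast

text \<open>Projections are firmly nonexpansive; the additional term on the left is what later yields a rate for the
  alternating projections.\<close>

lemma metric_projection_firm:
  fixes S :: "'a::{real_inner,complete_space} set"
  assumes "S \<noteq> {}" "closed S" "convex S"
  defines "p \<equiv> metric_projection S"
  shows "(norm (p u - p v))\<^sup>2 + (norm ((u - p u) - (v - p v)))\<^sup>2 \<le> (norm (u - v))\<^sup>2"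
proof -
  have "(u - p u) \<bullet> (p v - p u) \<le> 0" "(v - p v) \<bullet> (p u - p v) \<le> 0"
    unfolding p_def using metric_projection_nearest[OF assms(1-3)]
    by (auto intro!: metric_projection_obtuse[OF assms(1-3)])
  then show ?thesis
    unfolding power2_norm_eq_inner by (simp add: inner_simps inner_commute)
qed

lemma metric_projection_nonexpansive:
  fixes S :: "'a::{real_inner,complete_space} set"
  assumes "S \<noteq> {}" "closed S" "convex S"
  shows "norm (metric_projection S u - metric_projection S v) \<le> norm (u - v)"
proof (rule power2_le_imp_le)
  show "(norm (metric_projection S u - metric_projection S v))\<^sup>2 \<le> (norm (u - v))\<^sup>2"
    using metric_projection_firm[OF assms, of u v]
      zero_le_power2[of "norm ((u - metric_projection S u) - (v - metric_projection S v))"] by linarith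
qed simp

text \<open>With \<open>a = P\<^sub>M v\<close> and \<open>b = P\<^sub>N u\<close>, the obtuse angles at \<open>b\<close> (towards \<open>v\<close>) and at \<open>a\<close> (towards \<open>u\<close>), added to
  \<open>\<parallel>u + v - a - b\<parallel>\<^sup>2 \<ge> 0\<close>, give exactly the comparison of \<open>\<parallel>a - b\<parallel>\<close> with \<open>\<parallel>u - v\<parallel>\<close>.\<close>

lemma crossed_projections_nonexpansive:
  fixes M N :: "'a::{real_inner,complete_space} set"
  assumes "M \<noteq> {}" "closed M" "convex M" "N \<noteq> {}" "closed N" "convex N" and uv: "u \<in> M" "v \<in> N"
  shows "norm (metric_projection M v - metric_projection N u) \<le> norm (u - v)"
proof -
  define a b where "a = metric_projection M v" and "b = metric_projection N u"
  have "(v - a) \<bullet> (u - a) \<le> 0" "(u - b) \<bullet> (v - b) \<le> 0"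
    unfolding a_def b_def using assms by (auto intro!: metric_projection_obtuse)
  moreover have "0 \<le> (norm (u + v - a - b))\<^sup>2" by simp
  ultimately have "(norm (a - b))\<^sup>2 \<le> (norm (u - v))\<^sup>2"
    unfolding power2_norm_eq_inner by (simp add: inner_simps inner_commute)
  then show ?thesis unfolding a_def b_def by (rule power2_le_imp_le) simp
qed

section \<open>Fixed points of nonexpansive maps\<close>

text \<open>If \<open>T\<close> is nonexpansive and \<open>T x = (1 + \<alpha>) x\<close>, \<open>T y = (1 + \<beta>) y\<close>, then the premise below holds.  So approximate
  fixed points get longer as \<open>\<alpha>\<close> decreases, and the growth of the squared length bounds their distance.\<close>

lemma resolvent_sq_dist_le:
  fixes x y :: "'a::real_inner"
  assumes "norm ((1 + \<alpha>) *\<^sub>R x - (1 + \<beta>) *\<^sub>R y) \<le> norm (x - y)" "\<beta> \<le> \<alpha>" "0 < \<beta>"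
  shows "(norm (x - y))\<^sup>2 \<le> (norm y)\<^sup>2 - (norm x)\<^sup>2"
proof -
  define d where "d = (norm (x - y))\<^sup>2"
  define g where "g = (norm y)\<^sup>2 - (norm x)\<^sup>2"
  have "(norm ((1 + \<alpha>) *\<^sub>R x - (1 + \<beta>) *\<^sub>R y))\<^sup>2 \<le> (norm (x - y))\<^sup>2"
    using assms(1) by (intro power_mono) auto
  moreover have "(norm ((1 + \<alpha>) *\<^sub>R x - (1 + \<beta>) *\<^sub>R y))\<^sup>2 =
      (norm (x - y))\<^sup>2 + 2 * ((x - y) \<bullet> (\<alpha> *\<^sub>R x - \<beta> *\<^sub>R y)) + (norm (\<alpha> *\<^sub>R x - \<beta> *\<^sub>R y))\<^sup>2"
    unfolding power2_norm_eq_inner by (simp add: inner_simps inner_commute algebra_simps)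
  moreover have "2 * ((x - y) \<bullet> (\<alpha> *\<^sub>R x - \<beta> *\<^sub>R y)) = (\<alpha> + \<beta>) * d - (\<alpha> - \<beta>) * g"
    unfolding d_def g_def power2_norm_eq_inner by (simp add: inner_simps inner_commute algebra_simps)
  ultimately have le: "(\<alpha> + \<beta>) * d \<le> (\<alpha> - \<beta>) * g"
    using zero_le_power2[of "norm (\<alpha> *\<^sub>R x - \<beta> *\<^sub>R y)"] by linarith
  have d0: "0 \<le> d" by (simp add: d_def)
  show ?thesis
  proof (cases "\<alpha> = \<beta>")
    case True
    then have "d \<le> 0" using le assms(3) by (simp add: mult_le_0_iff)
    then have "x = y" by (simp add: d_def)
    then show ?thesis by simp
  next
    case False
    have "(\<alpha> - \<beta>) * d \<le> (\<alpha> + \<beta>) * d" using assms(3) d0 by (intro mult_right_mono) auto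
    with le have "(\<alpha> - \<beta>) * d \<le> (\<alpha> - \<beta>) * g" by linarith
    then show ?thesis using False assms(2) by (simp add: d_def g_def)
  qed
qed

text \<open>Browder's fixed point theorem.  Translated so that the base point \<open>c\<close> is the origin, the fixed point \<open>x\<^sub>n\<close> of the
  contraction \<open>x \<mapsto> (T x + \<alpha>\<^sub>n c) / (1 + \<alpha>\<^sub>n)\<close> satisfies \<open>T x\<^sub>n = (1 + \<alpha>\<^sub>n) x\<^sub>n\<close>; with \<open>\<alpha>\<^sub>n \<down> 0\<close> the preceding
  lemma makes \<open>x\<^sub>n\<close> Cauchy.\<close>

lemma nonexpansive_fixed_point:
  fixes C :: "'a::{real_inner,complete_space} set"
  assumes "C \<noteq> {}" "bounded C" "closed C" "convex C" and maps: "T ` C \<subseteq> C"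
    and ne: "\<And>u v. u \<in> C \<Longrightarrow> v \<in> C \<Longrightarrow> norm (T u - T v) \<le> norm (u - v)"
  obtains p where "p \<in> C" "T p = p"
proof -
  obtain c where c: "c \<in> C" using assms(1) by blast
  \<comment> \<open>\<open>t\<close> is chosen so that \<open>1 / (1 - t n) = 1 + \<alpha> n\<close>.\<close>
  define t where "t n = 1 / real (n + 2)" for n
  define \<alpha> where "\<alpha> n = 1 / real (Suc n)" for n
  have t: "0 < t n" "t n < 1" for n by (auto simp: t_def field_simps)
  have t\<alpha>: "(1 - t n) * (1 + \<alpha> n) = 1" for n
  proof -
    have "1 - t n = real (n + 1) / real (n + 2)" "1 + \<alpha> n = real (n + 2) / real (n + 1)"
      by (simp_all add: t_def \<alpha>_def field_simps)
    then show ?thesis by simp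
  qed
  have "\<exists>!x\<in>C. (1 - t n) *\<^sub>R T x + t n *\<^sub>R c = x" for n
  proof (rule Banach_fix[of C "1 - t n"])
    show "complete C" using assms(3) by (simp add: complete_eq_closed)
    show "(\<lambda>x. (1 - t n) *\<^sub>R T x + t n *\<^sub>R c) ` C \<subseteq> C"
      using maps c t[of n] convexD[OF assms(4)] by (auto simp: image_subset_iff)
    show "dist ((1 - t n) *\<^sub>R T x + t n *\<^sub>R c) ((1 - t n) *\<^sub>R T y + t n *\<^sub>R c) \<le> (1 - t n) * dist x y"
      if "x \<in> C" "y \<in> C" for x y
    proof -
      have "dist ((1 - t n) *\<^sub>R T x + t n *\<^sub>R c) ((1 - t n) *\<^sub>R T y + t n *\<^sub>R c)
          = (1 - t n) * norm (T x - T y)"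
        using t[of n] by (simp add: dist_norm flip: scaleR_diff_right)
      also have "\<dots> \<le> (1 - t n) * dist x y"
        using ne[OF that] t[of n] by (simp add: dist_norm mult_left_mono)
      finally show ?thesis .
    qed
  qed (use assms(1) t[of n] in auto)
  then obtain x where xC: "\<And>n. x n \<in> C" and x: "\<And>n. (1 - t n) *\<^sub>R T (x n) + t n *\<^sub>R c = x n"
    by metis
  have Tx: "T (x n) = x n + \<alpha> n *\<^sub>R (x n - c)" for n
  proof -
    have "x n - c = (1 - t n) *\<^sub>R (T (x n) - c)"
      by (subst x[of n, symmetric]) (simp add: algebra_simps)
    then have "(1 + \<alpha> n) *\<^sub>R (x n - c) = ((1 - t n) * (1 + \<alpha> n)) *\<^sub>R (T (x n) - c)"
      by (simp add: mult.commute)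
    then have "(1 + \<alpha> n) *\<^sub>R (x n - c) = T (x n) - c" by (simp only: t\<alpha> scaleR_one)
    then show ?thesis by (simp add: algebra_simps)
  qed
  define g where "g n = (norm (x n - c))\<^sup>2" for n
  have key: "(norm (x m - x n))\<^sup>2 \<le> g n - g m" if "m \<le> n" for m n
  proof -
    have eq: "(1 + \<alpha> m) *\<^sub>R (x m - c) - (1 + \<alpha> n) *\<^sub>R (x n - c) = T (x m) - T (x n)"
      by (simp add: Tx algebra_simps)
    have "(norm ((x m - c) - (x n - c)))\<^sup>2 \<le> (norm (x n - c))\<^sup>2 - (norm (x m - c))\<^sup>2"
    proof (rule resolvent_sq_dist_le)
      show "norm ((1 + \<alpha> m) *\<^sub>R (x m - c) - (1 + \<alpha> n) *\<^sub>R (x n - c)) \<le> norm ((x m - c) - (x n - c))"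
        unfolding eq using ne[OF xC xC, of m n] by simp
      show "\<alpha> n \<le> \<alpha> m" using that by (simp add: \<alpha>_def field_simps)
      show "0 < \<alpha> n" by (simp add: \<alpha>_def)
    qed
    then show ?thesis by (simp add: g_def)
  qed
  have inc: "incseq g"
  proof (rule incseq_SucI)
    show "g n \<le> g (Suc n)" for n
      using key[of n "Suc n"] zero_le_power2[of "norm (x n - x (Suc n))"] by linarith
  qed
  obtain B where B: "\<And>u. u \<in> C \<Longrightarrow> norm (u - c) \<le> B"
    using assms(2) by (metis bounded_any_center dist_norm norm_minus_commute)
  have "g n \<le> B\<^sup>2" for n unfolding g_def by (intro power_mono B xC) simp
  then obtain L where L: "g \<longlonglongrightarrow> L" using incseq_convergent[OF inc] by metis
  have "Cauchy x"
  proof (rule Cauchy_if_sq_dist_le)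
    show "(norm (x m - x n))\<^sup>2 \<le> L - g m" if "m \<le> n" for m n
      using key[OF that] incseq_le[OF inc L, of n] by linarith
    show "(\<lambda>m. L - g m) \<longlonglongrightarrow> 0" using tendsto_diff[OF tendsto_const L, of L] by simp
  qed
  then obtain p where p: "x \<longlonglongrightarrow> p" using Cauchy_convergent convergent_def by blast
  have pC: "p \<in> C" using closed_sequentially[OF assms(3) _ p] xC by blast
  have "(\<lambda>n. T (x n)) \<longlonglongrightarrow> T p"
  proof (rule LIM_zero_cancel, rule Lim_null_comparison)
    show "\<forall>\<^sub>F n in sequentially. norm (T (x n) - T p) \<le> norm (x n - p)"
      using ne[OF xC pC] by simp
    show "(\<lambda>n. norm (x n - p)) \<longlonglongrightarrow> 0" using p by (simp add: LIM_zero tendsto_norm_zero)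
  qed
  moreover have "(\<lambda>n. T (x n)) \<longlonglongrightarrow> p"
  proof -
    have "\<alpha> \<longlonglongrightarrow> 0" unfolding \<alpha>_def using LIMSEQ_Suc[OF lim_1_over_n] .
    then have "(\<lambda>n. x n + \<alpha> n *\<^sub>R (x n - c)) \<longlonglongrightarrow> p + 0 *\<^sub>R (p - c)"
      by (intro tendsto_intros p)
    then show ?thesis by (simp add: Tx)
  qed
  ultimately have "T p = p" by (rule LIMSEQ_unique)
  with pC that show ?thesis by blast
qed

section \<open>The gap vector of two convex sets\<close>

text \<open>The element of least norm in \<open>N - M\<close>, described by its variational inequality.\<close>

definition gap_vector :: "'a::real_inner set \<Rightarrow> 'a set \<Rightarrow> 'a \<Rightarrow> bool"
  where "gap_vector M N h \<longleftrightarrow>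
    (\<exists>x\<in>M. x + h \<in> N) \<and> (\<forall>u\<in>M. \<forall>v\<in>N. (norm h)\<^sup>2 \<le> h \<bullet> (v - u))"

lemma gap_vector_defect:
  assumes "gap_vector M N h" "u \<in> M" "v \<in> N"
  shows "(norm (v - u - h))\<^sup>2 + (norm h)\<^sup>2 \<le> (norm (v - u))\<^sup>2"
proof -
  have "(norm h)\<^sup>2 \<le> h \<bullet> (v - u)" using assms by (auto simp: gap_vector_def)
  then show ?thesis unfolding power2_norm_eq_inner by (simp add: inner_simps inner_commute)
qed

lemma gap_vector_le:
  assumes "gap_vector M N h" "u \<in> M" "v \<in> N"
  shows "norm h \<le> norm (v - u)"
proof (rule power2_le_imp_le)
  show "(norm h)\<^sup>2 \<le> (norm (v - u))\<^sup>2"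
    using gap_vector_defect[OF assms] zero_le_power2[of "norm (v - u - h)"] by linarith
qed simp

lemma gap_vector_attained:
  assumes "gap_vector M N h" "u \<in> M" "v \<in> N" "norm (v - u) \<le> norm h"
  shows "v = u + h"
proof -
  have "(norm (v - u))\<^sup>2 \<le> (norm h)\<^sup>2" using assms(4) by (intro power_mono) auto
  then have "(norm (v - u - h))\<^sup>2 \<le> 0" using gap_vector_defect[OF assms(1-3)] by linarith
  then show ?thesis by (simp add: algebra_simps)
qed

text \<open>A fixed point \<open>x\<close> of the alternating projection has \<open>P\<^sub>N x - x\<close> as gap vector: the obtuse angles at \<open>P\<^sub>N x\<close>
  and at \<open>x = P\<^sub>M (P\<^sub>N x)\<close> add up to the variational inequality.\<close>

lemma gap_vector_exists:
  fixes M N :: "'a::{real_inner,complete_space} set"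
  assumes M: "M \<noteq> {}" "closed M" "convex M" and N: "N \<noteq> {}" "closed N" "convex N" and "bounded M"
  obtains h where "gap_vector M N h"
proof -
  have inM: "projection_comp M N u \<in> M" for u
    using metric_projection_nearest[OF M] by (auto simp: projection_comp_def)
  obtain x where x: "x \<in> M" "projection_comp M N x = x"
  proof (rule nonexpansive_fixed_point[OF M(1) \<open>bounded M\<close> M(2,3)])
    show "projection_comp M N ` M \<subseteq> M" using inM by blast
    show "norm (projection_comp M N u - projection_comp M N v) \<le> norm (u - v)" for u v
      unfolding projection_comp_def
      using metric_projection_nonexpansive[OF M] metric_projection_nonexpansive[OF N] by (rule order_trans)
  qed blast
  define y where "y = metric_projection N x"
  have y: "y \<in> N" using metric_projection_nearest[OF N] by (simp add: y_def)
  have xy: "metric_projection M y = x" using x(2) by (simp add: projection_comp_def y_def)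
  have "gap_vector M N (y - x)"
    unfolding gap_vector_def
  proof (intro conjI ballI)
    show "\<exists>x'\<in>M. x' + (y - x) \<in> N" using x(1) y by (auto intro!: bexI[of _ x])
  next
    fix u v assume uv: "u \<in> M" "v \<in> N"
    have "(y - x) \<bullet> (u - x) \<le> 0" using metric_projection_obtuse[OF M uv(1), of y] by (simp add: xy)
    moreover have "(x - y) \<bullet> (v - y) \<le> 0"
      using metric_projection_obtuse[OF N uv(2), of x] by (simp add: y_def)
    ultimately show "(norm (y - x))\<^sup>2 \<le> (y - x) \<bullet> (v - u)"
      unfolding power2_norm_eq_inner by (simp add: inner_simps inner_commute)
  qed
  then show ?thesis by (rule that)
qed

lemma projection_of_proximal_pair:
  fixes M N :: "'a::{real_inner,complete_space} set"
  assumes "M \<noteq> {}" "closed M" "convex M" "N \<noteq> {}" "closed N" "convex N"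
    and gap: "gap_vector M N h" and x: "x \<in> M" "x + h \<in> N"
  shows "metric_projection N x = x + h" "metric_projection M (x + h) = x"
proof -
  show "metric_projection N x = x + h"
    using assms gap_vector_le[OF gap x(1)]
    by (intro metric_projection_eqI) (simp_all add: dist_norm norm_minus_commute[of x])
  show "metric_projection M (x + h) = x"
    using assms gap_vector_le[OF gap _ x(2)] by (intro metric_projection_eqI) (simp_all add: dist_norm)
qed

text \<open>The point \<open>y = x + h\<close> is in general not fixed by \<open>P\<^sub>M \<circ> P\<^sub>N\<close>, but the crossed estimate is used
  twice, first with \<open>y\<close> sent to \<open>x\<close> and then with \<open>x\<close> sent back to \<open>y\<close>.\<close>

lemma projection_comp_dist_proximal:
  fixes M N :: "'a::{real_inner,complete_space} set"
  assumes M: "M \<noteq> {}" "closed M" "convex M" and N: "N \<noteq> {}" "closed N" "convex N"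
    and gap: "gap_vector M N h" and x: "x \<in> M" "x + h \<in> N" and u: "u \<in> M"
  shows "norm (projection_comp M N u - (x + h)) \<le> norm (u - (x + h))"
proof -
  have v: "metric_projection N u \<in> N" using metric_projection_nearest[OF N] by blast
  have "norm (projection_comp M N u - (x + h)) \<le> norm (x - metric_projection N u)"
    using crossed_projections_nonexpansive[OF M N x(1) v]
      projection_of_proximal_pair(1)[OF M N gap x] by (simp add: projection_comp_def)
  also have "\<dots> \<le> norm (u - (x + h))"
    using crossed_projections_nonexpansive[OF M N u x(2)]
      projection_of_proximal_pair(2)[OF M N gap x] by simp
  finally show ?thesis .
qed

lemma projection_comp_iterate_in:
  fixes M N :: "'a::{real_inner,complete_space} set"
  assumes "M \<noteq> {}" "closed M" "convex M" and "u \<in> M"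
  shows "(projection_comp M N ^^ n) u \<in> M"
  using assms(4) metric_projection_nearest[OF assms(1-3)]
  by (induction n) (auto simp: projection_comp_def)

lemma projection_comp_iterate_dist_proximal:
  fixes M N :: "'a::{real_inner,complete_space} set"
  assumes M: "M \<noteq> {}" "closed M" "convex M" and N: "N \<noteq> {}" "closed N" "convex N"
    and gap: "gap_vector M N h" and x: "x \<in> M" "x + h \<in> N" and u: "u \<in> M"
  shows "norm ((projection_comp M N ^^ n) u - (x + h)) \<le> norm (u - (x + h))"
proof (induction n)
  case (Suc n)
  show ?case
    using order_trans[OF projection_comp_dist_proximal[OF M N gap x projection_comp_iterate_in[OF M u]] Suc.IH]
    by simp
qed simp

text \<open>Firm nonexpansiveness makes \<open>\<parallel>P\<^sup>k u - x\<parallel>\<^sup>2\<close> drop at step \<open>k\<close> by the square of the excess over \<open>\<parallel>h\<parallel>\<close> of the distance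
  to \<open>N\<close>.  That distance decreases with \<open>k\<close>, so the first \<open>n\<close> drops are all at least the square of the excess at \<open>n\<close>.\<close>

lemma iterates_approach_gap:
  fixes M N :: "'a::{real_inner,complete_space} set"
  assumes M: "M \<noteq> {}" "closed M" "convex M" and N: "N \<noteq> {}" "closed N" "convex N"
    and gap: "gap_vector M N h" and x: "x \<in> M" "x + h \<in> N" and u: "u \<in> M"
  defines "a \<equiv> \<lambda>n. (projection_comp M N ^^ n) u"
  shows "real n * (norm (a n - metric_projection N (a n)) - norm h)\<^sup>2 \<le> (norm (u - x))\<^sup>2"
proof -
  define e where "e n = norm (a n - metric_projection N (a n))" for n
  have aM: "a n \<in> M" for n unfolding a_def by (rule projection_comp_iterate_in[OF M u])
  have bN: "metric_projection N v \<in> N" for v using metric_projection_nearest[OF N] by blast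
  have a_Suc: "a (Suc n) = metric_projection M (metric_projection N (a n))" for n
    by (simp add: a_def projection_comp_def)
  have drop: "(norm (a (Suc n) - x))\<^sup>2 + (e n - norm h)\<^sup>2 \<le> (norm (a n - x))\<^sup>2" for n
  proof -
    define b where "b = metric_projection N (a n)"
    have "norm (a (Suc n) - x) \<le> norm (b - (x + h))"
      using metric_projection_nonexpansive[OF M, of b "x + h"] projection_of_proximal_pair(2)[OF M N gap x]
      by (simp add: a_Suc b_def)
    then have "(norm (a (Suc n) - x))\<^sup>2 \<le> (norm (b - (x + h)))\<^sup>2" by (intro power_mono) auto
    moreover have "(norm (b - (x + h)))\<^sup>2 + (norm ((a n - b) + h))\<^sup>2 \<le> (norm (a n - x))\<^sup>2"
      using metric_projection_firm[OF N, of "a n" x] projection_of_proximal_pair(1)[OF M N gap x]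
      by (simp add: b_def)
    moreover have "(e n - norm h)\<^sup>2 \<le> (norm ((a n - b) + h))\<^sup>2"
    proof -
      have "\<bar>norm (a n - b) - norm (- h)\<bar> \<le> norm ((a n - b) - (- h))" by (rule norm_triangle_ineq3)
      then show ?thesis by (intro abs_le_square_iff[THEN iffD1]) (simp add: e_def b_def)
    qed
    ultimately show ?thesis by linarith
  qed
  have dec: "e (Suc n) \<le> e n" for n
  proof -
    define b where "b = metric_projection N (a n)"
    have "e (Suc n) \<le> dist (a (Suc n)) b"
      using metric_projection_nearest[OF N, of "a (Suc n)"] bN by (simp add: e_def b_def dist_norm)
    also have "\<dots> \<le> dist (a n) b"
      using metric_projection_nearest[OF M, of b] aM[of n] by (simp add: a_Suc b_def dist_commute)
    finally show ?thesis by (simp add: e_def b_def dist_norm)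
  qed
  have ge: "norm h \<le> e n" for n
    using gap_vector_le[OF gap aM bN] by (simp add: e_def norm_minus_commute)
  have "real n * (e n - norm h)\<^sup>2 + (norm (a n - x))\<^sup>2 \<le> (norm (u - x))\<^sup>2"
  proof (induction n)
    case 0
    then show ?case by (simp add: a_def)
  next
    case (Suc n)
    have "(e (Suc n) - norm h)\<^sup>2 \<le> (e n - norm h)\<^sup>2"
      using dec[of n] ge[of "Suc n"] by (intro power_mono) auto
    then have "real (Suc n) * (e (Suc n) - norm h)\<^sup>2 \<le> real (Suc n) * (e n - norm h)\<^sup>2"
      by (intro mult_left_mono) auto
    also have "\<dots> = real n * (e n - norm h)\<^sup>2 + (e n - norm h)\<^sup>2" by (simp add: algebra_simps)
    finally show ?case using drop[of n] Suc.IH by linarith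
  qed
  then show ?thesis unfolding e_def using zero_le_power2[of "norm (a n - x)"] by linarith
qed

section \<open>Relatively nonexpansive maps\<close>

lemma relatively_nonexpansive_translate:
  fixes F :: "'a::real_inner \<Rightarrow> 'a"
  assumes "F ` M \<subseteq> M" "F ` N \<subseteq> N"
    and "\<And>u v. u \<in> M \<Longrightarrow> v \<in> N \<Longrightarrow> norm (F u - F v) \<le> norm (u - v)"
    and gap: "gap_vector M N h" and x: "x \<in> M" "x + h \<in> N"
  shows "F (x + h) = F x + h"
proof (rule gap_vector_attained[OF gap])
  show "F x \<in> M" "F (x + h) \<in> N" using assms by auto
  show "norm (F (x + h) - F x) \<le> norm h"
    using assms(3)[OF x] by (simp add: norm_minus_commute)
qed

text \<open>For \<open>u, v\<close> in the proximal set, the relative condition applies to \<open>(u, v + h)\<close> and to \<open>(v, u + h)\<close>.  Adding the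
  squares of the two inequalities cancels the terms in \<open>h\<close> and shows that \<open>F\<close> is nonexpansive there.\<close>

lemma fixed_point_in_proximal_set:
  fixes F :: "'a::{real_inner,complete_space} \<Rightarrow> 'a"
  assumes M: "bounded M" "closed M" "convex M" and N: "closed N" "convex N"
    and F: "F ` M \<subseteq> M" "F ` N \<subseteq> N"
      "\<And>u v. u \<in> M \<Longrightarrow> v \<in> N \<Longrightarrow> norm (F u - F v) \<le> norm (u - v)"
    and gap: "gap_vector M N h"
  obtains x where "x \<in> M" "x + h \<in> N" "F (x + h) = x + h"
proof -
  define C where "C = M \<inter> (+) (- h) ` N"
  have C: "x \<in> C \<longleftrightarrow> x \<in> M \<and> x + h \<in> N" for x
    by (auto simp: C_def image_iff algebra_simps intro!: bexI[of _ "x + h"])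
  note tr = relatively_nonexpansive_translate[OF F gap]
  obtain x where x: "x \<in> C" "F x = x"
  proof (rule nonexpansive_fixed_point[of C F])
    show "C \<noteq> {}" using gap C by (auto simp: gap_vector_def)
    show "bounded C" using M(1) by (auto simp: C_def intro: bounded_subset)
    show "closed C" unfolding C_def using M(2) N(1) by (intro closed_Int closed_translation)
    show "convex C" unfolding C_def using M(3) N(2) by (intro convex_Int convex_translation)
    show "F ` C \<subseteq> C" using F(1,2) tr by (force simp: C image_subset_iff)
    show "norm (F u - F v) \<le> norm (u - v)" if "u \<in> C" "v \<in> C" for u v
    proof (rule power2_le_imp_le)
      have "norm (F u - (F v + h)) \<le> norm (u - (v + h))" "norm (F v - (F u + h)) \<le> norm (v - (u + h))"
        using F(3)[of u "v + h"] F(3)[of v "u + h"] that tr by (auto simp: C)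
      then have "(norm (F u - (F v + h)))\<^sup>2 \<le> (norm (u - (v + h)))\<^sup>2"
        "(norm (F v - (F u + h)))\<^sup>2 \<le> (norm (v - (u + h)))\<^sup>2" by (auto intro!: power_mono)
      then show "(norm (F u - F v))\<^sup>2 \<le> (norm (u - v))\<^sup>2"
        unfolding power2_norm_eq_inner by (simp add: inner_simps inner_commute)
    qed simp
  qed blast
  show ?thesis using that[of x] x tr[of x] by (simp add: C)
qed

lemma norm_sq_convex_combination:
  fixes u v y :: "'a::real_inner"
  shows "(norm ((1 - t) *\<^sub>R u + t *\<^sub>R v - y))\<^sup>2 =
    (1 - t) * (norm (u - y))\<^sup>2 + t * (norm (v - y))\<^sup>2 - t * (1 - t) * (norm (u - v))\<^sup>2"
  unfolding power2_norm_eq_inner by (simp add: inner_simps inner_commute algebra_simps)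

text \<open>The two nested averages of the iteration, measured from a point \<open>y\<close> to which \<open>F\<close> does not increase
  distances.  The inner average gains \<open>\<delta> (1 - \<delta>) \<ge> \<epsilon>\<^sup>2\<close> times the squared displacement, and the outer one keeps the
  fraction \<open>\<eta> \<ge> \<epsilon>\<close> of that gain.\<close>

lemma nested_average_decrease:
  fixes u y :: "'a::real_inner"
  assumes \<epsilon>: "0 < \<epsilon>" and \<eta>: "\<epsilon> < \<eta>" "\<eta> < 1 - \<epsilon>" and \<delta>: "\<epsilon> < \<delta>" "\<delta> < 1 - \<epsilon>"
    and z: "z = (1 - \<delta>) *\<^sub>R u + \<delta> *\<^sub>R F u"
    and Fu: "norm (F u - y) \<le> norm (u - y)" and Fz: "norm (F z - y) \<le> norm (z - y)"
  shows "(norm ((1 - \<eta>) *\<^sub>R u + \<eta> *\<^sub>R F z - y))\<^sup>2 + \<epsilon> ^ 3 * (norm (u - F u))\<^sup>2 \<le> (norm (u - y))\<^sup>2"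
proof -
  define d where "d = (norm (u - F u))\<^sup>2"
  define A where "A = (norm (u - y))\<^sup>2"
  have d0: "0 \<le> d" by (simp add: d_def)
  have "(norm (F u - y))\<^sup>2 \<le> A" unfolding A_def using Fu by (intro power_mono) auto
  then have "\<delta> * (norm (F u - y))\<^sup>2 \<le> \<delta> * A" using \<delta> \<epsilon> by (intro mult_left_mono) auto
  moreover have "\<epsilon>\<^sup>2 * d \<le> \<delta> * (1 - \<delta>) * d"
    unfolding power2_eq_square using \<delta> \<epsilon> d0 by (intro mult_right_mono mult_mono) auto
  moreover have "(norm (z - y))\<^sup>2 = (1 - \<delta>) * A + \<delta> * (norm (F u - y))\<^sup>2 - \<delta> * (1 - \<delta>) * d"
    unfolding z A_def d_def by (rule norm_sq_convex_combination)
  ultimately have zy: "(norm (z - y))\<^sup>2 \<le> A - \<epsilon>\<^sup>2 * d" by (simp add: algebra_simps)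
  have "(norm (F z - y))\<^sup>2 \<le> (norm (z - y))\<^sup>2" using Fz by (intro power_mono) auto
  with zy have "(norm (F z - y))\<^sup>2 \<le> A - \<epsilon>\<^sup>2 * d" by linarith
  then have "\<eta> * (norm (F z - y))\<^sup>2 \<le> \<eta> * (A - \<epsilon>\<^sup>2 * d)" using \<eta> \<epsilon> by (intro mult_left_mono) auto
  moreover have "0 \<le> \<eta> * (1 - \<eta>) * (norm (u - F z))\<^sup>2" using \<eta> \<epsilon> by simp
  moreover have "(norm ((1 - \<eta>) *\<^sub>R u + \<eta> *\<^sub>R F z - y))\<^sup>2 =
      (1 - \<eta>) * A + \<eta> * (norm (F z - y))\<^sup>2 - \<eta> * (1 - \<eta>) * (norm (u - F z))\<^sup>2"
    unfolding A_def by (rule norm_sq_convex_combination)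
  moreover have "\<epsilon> ^ 3 * d \<le> \<eta> * (\<epsilon>\<^sup>2 * d)"
  proof -
    have "\<epsilon> ^ 3 * d = \<epsilon> * (\<epsilon>\<^sup>2 * d)" by (simp add: power2_eq_square power3_eq_cube)
    also have "\<dots> \<le> \<eta> * (\<epsilon>\<^sup>2 * d)" using \<eta> d0 by (intro mult_right_mono) auto
    finally show ?thesis .
  qed
  ultimately show ?thesis unfolding A_def[symmetric] d_def[symmetric] by (simp add: algebra_simps)
qed

text \<open>The relative condition replaces continuity of \<open>F\<close> at \<open>q\<close>: comparing \<open>F\<close> along the sequence with \<open>F\<close> at
  \<open>q + h\<close> only, it leaves \<open>F (q + h)\<close> at distance at most \<open>\<parallel>h\<parallel>\<close> from \<open>q\<close>, and \<open>q + h\<close> is the only such point of \<open>N\<close>.\<close>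

lemma proximal_cluster_point_fixed:
  fixes F :: "'a::real_inner \<Rightarrow> 'a"
  assumes F: "F ` M \<subseteq> M" "F ` N \<subseteq> N"
      "\<And>u v. u \<in> M \<Longrightarrow> v \<in> N \<Longrightarrow> norm (F u - F v) \<le> norm (u - v)"
    and gap: "gap_vector M N h" and q: "q \<in> M" "q + h \<in> N"
    and s: "\<And>k. s k \<in> M" "s \<longlonglongrightarrow> q" "(\<lambda>k. F (s k)) \<longlonglongrightarrow> q"
  shows "F q = q" "F (q + h) = q + h"
proof -
  have "norm (q - F (q + h)) \<le> norm (q - (q + h))"
  proof (rule LIMSEQ_le)
    show "(\<lambda>k. norm (F (s k) - F (q + h))) \<longlonglongrightarrow> norm (q - F (q + h))" by (intro tendsto_intros s)
    show "(\<lambda>k. norm (s k - (q + h))) \<longlonglongrightarrow> norm (q - (q + h))" by (intro tendsto_intros s)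
    show "\<exists>K. \<forall>k\<ge>K. norm (F (s k) - F (q + h)) \<le> norm (s k - (q + h))" using F(3)[OF s(1) q(2)] by blast
  qed
  then show Fqh: "F (q + h) = q + h"
    using F(2) q by (intro gap_vector_attained[OF gap]) (auto simp: norm_minus_commute)
  show "F q = q" using relatively_nonexpansive_translate[OF F gap q] Fqh by simp
qed

theorem theorem2p3:
  fixes M N :: "'a::{real_inner, complete_space} set"
    and F :: "'a \<Rightarrow> 'a"
    and \<epsilon> :: real
    and \<eta> \<delta> :: "nat \<Rightarrow> real"
    and w z :: "nat \<Rightarrow> 'a"
  assumes "M \<noteq> {}" "bounded M" "closed M" "convex M"
    and "N \<noteq> {}" "bounded N" "closed N" "convex N"
    and "F ` M \<subseteq> M" "F ` N \<subseteq> N"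
    and "\<And>u v. u \<in> M \<Longrightarrow> v \<in> N \<Longrightarrow> norm (F u - F v) \<le> norm (u - v)"
    and "\<epsilon> \<in> {0<..<1/2}"
    and "\<And>n. \<eta> n \<in> {\<epsilon><..<1 - \<epsilon>}"
    and "\<And>n. \<delta> n \<in> {\<epsilon><..<1 - \<epsilon>}"
    and "w 0 \<in> M"
    and "\<And>n. z n = (1 - \<delta> n) *\<^sub>R w n + \<delta> n *\<^sub>R F (w n)"
    and "\<And>n. w (Suc n) =
           (projection_comp M N ^^ n) ((1 - \<eta> n) *\<^sub>R w n + \<eta> n *\<^sub>R F (z n))"
  shows "(\<lambda>n. norm (w n - F (w n))) \<longlonglongrightarrow> 0 \<and>
    ((\<exists>K. compact K \<and> F ` M \<subseteq> K) \<and> (\<lambda>n. norm (w n - F (z n))) \<longlonglongrightarrow> 0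
       \<longrightarrow> (\<exists>p \<in> M \<union> N. F p = p \<and> w \<longlonglongrightarrow> p))"
proof -
  note M = assms(1,3,4) and N = assms(5,7,8) and F = assms(9-11)
  define u where "u n = (1 - \<eta> n) *\<^sub>R w n + \<eta> n *\<^sub>R F (z n)" for n
  define e where "e v = norm (v - metric_projection N v)" for v
  have w_Suc: "w (Suc n) = (projection_comp M N ^^ n) (u n)" for n by (simp add: assms(17) u_def)
  have \<epsilon>: "0 < \<epsilon>" and \<eta>: "\<epsilon> < \<eta> n" "\<eta> n < 1 - \<epsilon>" and \<delta>: "\<epsilon> < \<delta> n" "\<delta> n < 1 - \<epsilon>" for n
    using assms(12-14) by auto
  have zM: "z n \<in> M" if "w n \<in> M" for n
    unfolding assms(16) using that F(1) \<epsilon> \<delta>[of n] by (intro convexD[OF assms(4)]) auto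
  have uM: "u n \<in> M" if "w n \<in> M" for n
    unfolding u_def using that zM[OF that] F(1) \<epsilon> \<eta>[of n] by (intro convexD[OF assms(4)]) auto
  have wM: "w n \<in> M" for n
  proof (induction n)
    case (Suc n)
    then show ?case unfolding w_Suc by (intro projection_comp_iterate_in[OF M] uM)
  qed (rule assms(15))
  obtain h where gap: "gap_vector M N h" using gap_vector_exists[OF M N assms(2)] .

  \<comment> \<open>The estimate holds for every fixed proximal pair: any one serves for the residual, while the limit uses the
    pair at the cluster point.\<close>
  have decrease: "(norm (w (Suc n) - (x + h)))\<^sup>2 + \<epsilon> ^ 3 * (norm (w n - F (w n)))\<^sup>2
      \<le> (norm (w n - (x + h)))\<^sup>2"
    if x: "x \<in> M" "x + h \<in> N" "F (x + h) = x + h" for x n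
  proof -
    have "norm (w (Suc n) - (x + h)) \<le> norm (u n - (x + h))"
      unfolding w_Suc by (rule projection_comp_iterate_dist_proximal[OF M N gap x(1,2) uM[OF wM]])
    then have "(norm (w (Suc n) - (x + h)))\<^sup>2 \<le> (norm (u n - (x + h)))\<^sup>2" by (intro power_mono) auto
    moreover have "(norm (u n - (x + h)))\<^sup>2 + \<epsilon> ^ 3 * (norm (w n - F (w n)))\<^sup>2 \<le> (norm (w n - (x + h)))\<^sup>2"
      unfolding u_def using F(3)[OF wM x(2), of n] F(3)[OF zM[OF wM] x(2), of n] x(3)
      by (intro nested_average_decrease[where F = F, OF \<epsilon> \<eta> \<delta> assms(16)]) simp_all
    ultimately show ?thesis by linarith
  qed
  have dist_decseq: "decseq (\<lambda>n. (norm (w n - (x + h)))\<^sup>2)"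
    if "x \<in> M" "x + h \<in> N" "F (x + h) = x + h" for x
  proof (rule decseq_SucI)
    fix n
    have "0 \<le> \<epsilon> ^ 3 * (norm (w n - F (w n)))\<^sup>2" using \<epsilon> by simp
    then show "(norm (w (Suc n) - (x + h)))\<^sup>2 \<le> (norm (w n - (x + h)))\<^sup>2"
      using decrease[OF that, of n] by linarith
  qed

  have residual: "(\<lambda>n. norm (w n - F (w n))) \<longlonglongrightarrow> 0"
  proof -
    obtain x where x: "x \<in> M" "x + h \<in> N" "F (x + h) = x + h"
      using fixed_point_in_proximal_set[OF assms(2) M(2,3) N(2,3) F gap] .
    define a where "a n = (norm (w n - (x + h)))\<^sup>2" for n
    have "decseq a" unfolding a_def by (rule dist_decseq[OF x])
    then obtain L where L: "a \<longlonglongrightarrow> L"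
      using decseq_convergent[of a 0] by (auto simp: a_def)
    have "(\<lambda>n. (a n - a (Suc n)) / \<epsilon> ^ 3) \<longlonglongrightarrow> (L - L) / \<epsilon> ^ 3"
      using \<epsilon> by (intro tendsto_intros L LIMSEQ_Suc[OF L]) auto
    then have bound: "(\<lambda>n. (a n - a (Suc n)) / \<epsilon> ^ 3) \<longlonglongrightarrow> 0" by simp
    have "(\<lambda>n. (norm (w n - F (w n)))\<^sup>2) \<longlonglongrightarrow> 0"
    proof (rule tendsto_sandwich[OF _ _ tendsto_const bound])
      have "\<epsilon> ^ 3 * (norm (w n - F (w n)))\<^sup>2 \<le> a n - a (Suc n)" for n
        using decrease[OF x, of n] by (simp add: a_def)
      then show "\<forall>\<^sub>F n in sequentially. (norm (w n - F (w n)))\<^sup>2 \<le> (a n - a (Suc n)) / \<epsilon> ^ 3"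
        using \<epsilon> by (simp add: pos_le_divide_eq mult.commute)
    qed simp
    then show ?thesis using tendsto_real_sqrt by fastforce
  qed

  have gap_limit: "(\<lambda>n. e (w n)) \<longlonglongrightarrow> norm h"
  proof -
    obtain x where x: "x \<in> M" "x + h \<in> N" using gap by (auto simp: gap_vector_def)
    obtain B where B: "\<And>v. v \<in> M \<Longrightarrow> norm (v - x) \<le> B"
      using assms(2) by (metis bounded_any_center dist_norm norm_minus_commute)
    have bound: "(\<lambda>n. B\<^sup>2 * (1 / real n)) \<longlonglongrightarrow> 0"
      by (intro tendsto_mult_right_zero lim_1_over_n)
    have "(\<lambda>n. (e (w (Suc n)) - norm h)\<^sup>2) \<longlonglongrightarrow> 0"
    proof (rule tendsto_sandwich[OF _ _ tendsto_const bound])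
      have "(e (w (Suc n)) - norm h)\<^sup>2 \<le> B\<^sup>2 * (1 / real n)" if "0 < n" for n
      proof -
        have "real n * (e (w (Suc n)) - norm h)\<^sup>2 \<le> (norm (u n - x))\<^sup>2"
          unfolding e_def w_Suc by (rule iterates_approach_gap[OF M N gap x uM[OF wM]])
        also have "\<dots> \<le> B\<^sup>2" by (intro power_mono B uM wM) simp
        finally show ?thesis using that by (simp add: field_simps)
      qed
      then show "\<forall>\<^sub>F n in sequentially. (e (w (Suc n)) - norm h)\<^sup>2 \<le> B\<^sup>2 * (1 / real n)"
        using eventually_gt_at_top[of 0] by (rule eventually_mono[rotated])
    qed simp
    then have "(\<lambda>n. \<bar>e (w (Suc n)) - norm h\<bar>) \<longlonglongrightarrow> 0" using tendsto_real_sqrt by fastforce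
    then have "(\<lambda>n. e (w (Suc n))) \<longlonglongrightarrow> norm h" by (simp add: tendsto_rabs_zero_iff LIM_zero_cancel)
    then show ?thesis by (rule LIMSEQ_imp_Suc)
  qed

  have "\<exists>p\<in>M \<union> N. F p = p \<and> w \<longlonglongrightarrow> p" if K: "compact K" "F ` M \<subseteq> K" for K
  proof -
    have FwK: "\<forall>n. F (w n) \<in> K" using K(2) wM by blast
    obtain q r where r: "strict_mono r" and "((\<lambda>n. F (w n)) \<circ> r) \<longlonglongrightarrow> q"
      using seq_compactE[OF compact_imp_seq_compact[OF K(1)] FwK] by blast
    then have Fq: "(\<lambda>k. F (w (r k))) \<longlonglongrightarrow> q" by (simp add: o_def)
    have "(\<lambda>k. w (r k) - F (w (r k))) \<longlonglongrightarrow> 0"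
      using LIMSEQ_subseq_LIMSEQ[OF residual r] by (simp add: o_def tendsto_norm_zero_iff)
    then have wq: "(\<lambda>k. w (r k)) \<longlonglongrightarrow> q"
      using tendsto_add[OF _ Fq] by fastforce
    have qM: "q \<in> M" using closed_sequentially[OF assms(3) _ wq] wM by blast
    have "(\<lambda>k. metric_projection N (w (r k))) \<longlonglongrightarrow> metric_projection N q"
    proof (rule LIM_zero_cancel, rule Lim_null_comparison)
      show "\<forall>\<^sub>F k in sequentially.
          norm (metric_projection N (w (r k)) - metric_projection N q) \<le> norm (w (r k) - q)"
        using metric_projection_nonexpansive[OF N] by simp
      show "(\<lambda>k. norm (w (r k) - q)) \<longlonglongrightarrow> 0" using wq by (simp add: LIM_zero tendsto_norm_zero)
    qed
    then have "(\<lambda>k. e (w (r k))) \<longlonglongrightarrow> e q" unfolding e_def by (intro tendsto_intros wq)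
    then have "e q = norm h"
      by (rule LIMSEQ_unique) (use LIMSEQ_subseq_LIMSEQ[OF gap_limit r] in \<open>simp add: o_def\<close>)
    moreover have PqN: "metric_projection N q \<in> N" using metric_projection_nearest[OF N] by blast
    ultimately have "metric_projection N q = q + h"
      by (intro gap_vector_attained[OF gap qM]) (simp_all add: e_def norm_minus_commute[of q])
    then have qhN: "q + h \<in> N" using PqN by simp
    have fixed: "F q = q" "F (q + h) = q + h"
      using proximal_cluster_point_fixed[OF F gap qM qhN wM wq Fq] by simp_all
    \<comment> \<open>Monotonicity extends the limit \<open>\<parallel>h\<parallel>\<^sup>2\<close> from the subsequence to the whole sequence.\<close>
    define a where "a n = (norm (w n - (q + h)))\<^sup>2" for n
    have "decseq a" unfolding a_def by (rule dist_decseq[OF qM qhN fixed(2)])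
    then obtain L where L: "a \<longlonglongrightarrow> L"
      using decseq_convergent[of a 0] by (auto simp: a_def)
    have "(\<lambda>k. a (r k)) \<longlonglongrightarrow> (norm (q - (q + h)))\<^sup>2" unfolding a_def by (intro tendsto_intros wq)
    then have "(\<lambda>k. a (r k)) \<longlonglongrightarrow> (norm h)\<^sup>2" by simp
    then have "L = (norm h)\<^sup>2"
      using LIMSEQ_subseq_LIMSEQ[OF L r] by (intro LIMSEQ_unique[of "\<lambda>k. a (r k)"]) (simp_all add: o_def)
    with L have bound: "(\<lambda>n. a n - (norm h)\<^sup>2) \<longlonglongrightarrow> 0" by (simp add: LIM_zero)
    have "(\<lambda>n. (norm (w n - q))\<^sup>2) \<longlonglongrightarrow> 0"
    proof (rule tendsto_sandwich[OF _ _ tendsto_const bound])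
      have "(norm (w n - q))\<^sup>2 \<le> a n - (norm h)\<^sup>2" for n
      proof -
        have "q + h - w n - h = q - w n" by (simp add: algebra_simps)
        then have "(norm (q - w n))\<^sup>2 + (norm h)\<^sup>2 \<le> (norm (q + h - w n))\<^sup>2"
          using gap_vector_defect[OF gap wM qhN, of n] by (simp only:)
        then show ?thesis
          unfolding a_def norm_minus_commute[of "w n" q] norm_minus_commute[of "w n" "q + h"] by linarith
      qed
      then show "\<forall>\<^sub>F n in sequentially. (norm (w n - q))\<^sup>2 \<le> a n - (norm h)\<^sup>2" by simp
    qed simp
    then have "(\<lambda>n. norm (w n - q)) \<longlonglongrightarrow> 0" using tendsto_real_sqrt by fastforce
    then have "w \<longlonglongrightarrow> q" by (simp add: tendsto_norm_zero_iff LIM_zero_cancel)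
    with qM fixed show ?thesis by blast
  qed
  with residual show ?thesis by blast
qed

end
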